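(* Let $\|\cdot\|$ be a norm on $\mathbb{R}^n$ with dual norm $\|\cdot\|_*$. Let $\Psi:\mathbb{R}^n\to\mathbb{R}$ be a mirror potential that is $\sigma$-strongly convex with respect to $\|\cdot\|$, where $\sigma>0$, and let $B=B_\Psi$ be its Bregman distance. Let $f:\mathbb{R}^n\to\mathbb{R}$ be differentiable and $\mu$-strongly convex with respect to $\|\cdot\|$, where $\mu>0$, and let $x^*\in\mathbb{R}^n$ be a minimizer of $f$. Let $(t_k)_{k\ge1}$ be a sequence of step sizes with $t_k>0$. Let $(\tilde{x}_k)_{k\ge 1}$ be an arbitrary sequence in $\mathbb{R}^n$, and for $k\ge 1$ define the exact mirror descent iterates $$x_{k+1} = \operatorname*{arg\,min}_{x\in\mathbb{R}^n}\left\{\langle x, t_k\nabla f(\tilde{x}_k)\rangle + B(x,\tilde{x}_k)\right\} = (\nabla\Psi)^{-1}\left(\nabla\Psi(\tilde{x}_k) - t_k\nabla f(\tilde{x}_k)\right).$$ Then for every integer $K\ge 1$, $$\sum_{k=1}^K t_k\left(f(\tilde{x}_k) - f(x^* )\right) \le B(x^*,\tilde{x}_1) + \sum_{k=1}^K\left[\frac{1}{\sigma}t_k^2\|\nabla f(\tilde{x}_k)\|_*^2 + \left(\frac{1}{2t_k\mu}+\frac{1}{\sigma}\right)\|\nabla\Psi(\tilde{x}_{k+1}) - \nabla\Psi(x_{k+1})\|_*^2\right].$$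
   Context: A mirror potential is a continuously differentiable, strongly convex function $\Psi:\mathbb{R}^n\to\mathbb{R}$. Its Bregman distance is $B_\Psi(x,y) = \Psi(x)-\Psi(y)-\langle\nabla\Psi(y),x-y\rangle$. The dual norm is $\|y\|_* = \max\{\langle y,x\rangle : x\in\mathbb{R}^n,\ \|x\|\le 1\}$. A differentiable function $h$ is $c$-strongly convex with respect to $\|\cdot\|$ if $h(y)\ge h(x)+\langle\nabla h(x),y-x\rangle+\frac{c}{2}\|y-x\|^2$ for all $x,y$. Gradients are regarded as elements of the dual space $(\mathbb{R}^n)^*$. *)

theory Defs
  imports "HOL-Analysis.Analysis"
begin

definition is_norm :: "(real ^ 'n \<Rightarrow> real) \<Rightarrow> bool" where
  "is_norm N \<longleftrightarrow>
     (\<forall>x. 0 \<le> N x) \<and> (\<forall>x. N x = 0 \<longleftrightarrow> x = 0) \<and>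
     (\<forall>a x. N (a *\<^sub>R x) = \<bar>a\<bar> * N x) \<and>
     (\<forall>x y. N (x + y) \<le> N x + N y)"

text \<open>
  The dual space is the type of (bounded) linear functionals, and the pairing of a functional
  \<open>y\<close> with a vector \<open>x\<close> is the application \<open>blinfun_apply y x\<close>. The operator norm carried by this
  type is the dual of the Euclidean norm and is only used as a topology on the dual space.
\<close>

type_synonym 'n dual = "(real ^ 'n) \<Rightarrow>\<^sub>L real"

text \<open>
  A genuine maximum rather than a supremum: it is attained because the unit ball of any norm on a
  finite-dimensional space is compact. \<open>Max\<close> is not applicable, the set of values being infinite.
\<close>

definition dual_norm :: "(real ^ 'n \<Rightarrow> real) \<Rightarrow> 'n dual \<Rightarrow> real" where
  "dual_norm N y = (GREATEST r. \<exists>x. N x \<le> 1 \<and> r = blinfun_apply y x)"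

text \<open>Meaningful only at points of differentiability.\<close>

definition grad :: "(real ^ 'n \<Rightarrow> real) \<Rightarrow> real ^ 'n \<Rightarrow> 'n dual" where
  "grad h x = Blinfun (frechet_derivative h (at x))"

definition strongly_convex :: "(real ^ 'n \<Rightarrow> real) \<Rightarrow> real \<Rightarrow> (real ^ 'n \<Rightarrow> real) \<Rightarrow> bool" where
  "strongly_convex N c h \<longleftrightarrow>
     h differentiable_on UNIV \<and>
     (\<forall>x y. h y \<ge> h x + blinfun_apply (grad h x) (y - x) + c / 2 * (N (y - x))\<^sup>2)"

text \<open>All norms being equivalent, strong convexity with no norm specified means strong convexity
  with respect to some norm and some positive constant.\<close>

definition mirror_potential :: "(real ^ 'n \<Rightarrow> real) \<Rightarrow> bool" where
  "mirror_potential \<Psi> \<longleftrightarrow>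
     \<Psi> differentiable_on UNIV \<and> continuous_on UNIV (grad \<Psi>) \<and>
     (\<exists>N c. is_norm N \<and> c > 0 \<and> strongly_convex N c \<Psi>)"

definition bregman :: "(real ^ 'n \<Rightarrow> real) \<Rightarrow> real ^ 'n \<Rightarrow> real ^ 'n \<Rightarrow> real" where
  "bregman \<Psi> x y = \<Psi> x - \<Psi> y - blinfun_apply (grad \<Psi> y) (x - y)"

end

theory Submission imports Defs begin

text \<open>
  One step of the inequality is an exact identity followed by two applications of Young's
  inequality. Write \<open>a\<close>, \<open>b\<close>, \<open>c\<close> for the current point, the exact mirror descent step from it, and
  the point actually used next. The exact step is characterised by
  \<open>grad \<Psi> b = grad \<Psi> a - t g\<close> with \<open>g = grad f a\<close>, so for a minimizer \<open>s\<close> of \<open>f\<close>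

    \<open>t \<langle>g, a - s\<rangle> = \<langle>grad \<Psi> a - grad \<Psi> c, a - s\<rangle> + \<langle>grad \<Psi> c - grad \<Psi> b, a - s\<rangle>\<close>.

  The last term is the effect of the inexactness. It is controlled by the quadratic gain
  \<open>\<mu>/2 \<parallel>a - s\<parallel>\<^sup>2\<close> from the strong convexity of \<open>f\<close>, at the price \<open>1/(2t\<mu>)\<close> times the squared
  dual norm of the error. The first term equals \<open>B(s,a) - B(s,c) + B(a,c)\<close>
  (\<open>bregman_three_point\<close>): the difference telescopes, and \<open>B(a,c)\<close> is at most \<open>1/(2\<sigma>)\<close> times the
  squared dual norm of \<open>grad \<Psi> c - grad \<Psi> a\<close> (\<open>bregman_le_dual_norm\<close>), where
  \<open>grad \<Psi> c - grad \<Psi> a\<close> is the error minus \<open>t g\<close>.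

  That the exact step is well defined rests on coercivity: subtracting a linear functional from
  \<open>\<Psi>\<close> leaves a continuous function that grows quadratically, so it has a minimizer, at which the
  gradient of \<open>\<Psi>\<close> is the given functional (\<open>strongly_convex_minus_linear_attains_min\<close>). Uniqueness
  is strong monotonicity of the gradient.
\<close>

section \<open>Norms on a Euclidean space and their duals\<close>

lemma is_normD:
  assumes "is_norm N"
  shows "0 \<le> N x" and "N x = 0 \<longleftrightarrow> x = 0" and "N (a *\<^sub>R x) = \<bar>a\<bar> * N x"
    and "N (x + y) \<le> N x + N y"
  using assms unfolding is_norm_def by blast+

lemma is_norm_minus_commute:
  assumes "is_norm N"
  shows "N (x - y) = N (y - x)"
  using is_normD(3)[OF assms, of "-1" "x - y"] by simp

lemma is_norm_continuous_on:
  fixes N :: "real ^ 'n \<Rightarrow> real"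
  assumes "is_norm N"
  shows "continuous_on S N"
proof -
  have "convex_on UNIV N"
  proof (rule convex_onI)
    fix u :: real and x y :: "real ^ 'n"
    assume "0 < u" "u < 1"
    then show "N ((1 - u) *\<^sub>R x + u *\<^sub>R y) \<le> (1 - u) * N x + u * N y"
      using is_normD(4)[OF assms, of "(1 - u) *\<^sub>R x" "u *\<^sub>R y"]
      by (simp add: is_normD(3)[OF assms])
  qed simp
  then have "continuous_on UNIV N"
    by (intro convex_on_continuous) auto
  then show ?thesis
    by (rule continuous_on_subset) simp
qed

text \<open>The constant is the minimum of \<open>N\<close> on the Euclidean unit sphere, positive by definiteness.\<close>

lemma is_norm_ge_euclidean:
  fixes N :: "real ^ 'n \<Rightarrow> real"
  assumes "is_norm N"
  obtains c where "c > 0" and "\<And>x. c * norm x \<le> N x"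
proof -
  have "axis (undefined :: 'n) (1::real) \<in> sphere 0 1"
    by simp
  then have "sphere (0 :: real ^ 'n) 1 \<noteq> {}"
    by blast
  then obtain u where u: "u \<in> sphere 0 1" and min: "\<And>v. v \<in> sphere 0 1 \<Longrightarrow> N u \<le> N v"
    using continuous_attains_inf[OF compact_sphere _ is_norm_continuous_on[OF assms]] by metis
  have "u \<noteq> 0"
    using u by auto
  then have pos: "N u > 0"
    using is_normD(1,2)[OF assms, of u] by linarith
  have "N u * norm x \<le> N x" for x
  proof (cases "x = 0")
    case True
    then show ?thesis using is_normD(1)[OF assms, of x] by simp
  next
    case False
    then have "N u \<le> N ((1 / norm x) *\<^sub>R x)"
      by (intro min) simp
    also have "\<dots> = N x / norm x"
      by (simp add: is_normD(3)[OF assms])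
    finally show ?thesis
      using False by (simp add: field_simps)
  qed
  with pos show thesis by (rule that)
qed

lemma compact_is_norm_unit_ball:
  fixes N :: "real ^ 'n \<Rightarrow> real"
  assumes "is_norm N"
  shows "compact {x. N x \<le> 1}"
proof -
  obtain c where c: "c > 0" "\<And>x. c * norm x \<le> N x"
    using is_norm_ge_euclidean[OF assms] by blast
  have "norm x \<le> 1 / c" if "N x \<le> 1" for x
    using c(1) order_trans[OF c(2)[of x] that] by (simp add: field_simps)
  then have "bounded {x. N x \<le> 1}"
    by (auto simp: bounded_iff)
  moreover have "closed {x. N x \<le> 1}"
    by (intro closed_Collect_le is_norm_continuous_on[OF assms] continuous_on_const)
  ultimately show ?thesis
    by (simp add: compact_eq_bounded_closed)
qed

text \<open>Compactness of the unit ball makes the defining maximum of the dual norm exist.\<close>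

lemma dual_norm_attained:
  fixes N :: "real ^ 'n \<Rightarrow> real"
  assumes "is_norm N"
  obtains x where "N x \<le> 1" and "dual_norm N y = blinfun_apply y x"
    and "\<And>z. N z \<le> 1 \<Longrightarrow> blinfun_apply y z \<le> dual_norm N y"
proof -
  have "N 0 = 0"
    using is_normD(2)[OF assms] by simp
  then have "0 \<in> {x. N x \<le> 1}"
    by simp
  then have "{x. N x \<le> 1} \<noteq> {}"
    by blast
  moreover have "continuous_on {x. N x \<le> 1} (blinfun_apply y)"
    by (intro continuous_intros)
  ultimately obtain x where x: "N x \<le> 1"
    and max: "\<And>z. N z \<le> 1 \<Longrightarrow> blinfun_apply y z \<le> blinfun_apply y x"
    using continuous_attains_sup[OF compact_is_norm_unit_ball[OF assms], of "blinfun_apply y"]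
    by blast
  have "dual_norm N y = blinfun_apply y x"
    unfolding dual_norm_def using x max by (intro Greatest_equality) auto
  with x max show thesis
    using that by simp
qed

lemma abs_blinfun_apply_le_dual_norm:
  fixes N :: "real ^ 'n \<Rightarrow> real"
  assumes "is_norm N"
  shows "\<bar>blinfun_apply y x\<bar> \<le> dual_norm N y * N x"
proof -
  have bound: "blinfun_apply y x \<le> dual_norm N y * N x" for x
  proof (cases "x = 0")
    case True
    then show ?thesis using is_normD(2)[OF assms, of x] by (simp add: blinfun.zero_right)
  next
    case False
    then have pos: "N x > 0"
      using is_normD(1,2)[OF assms, of x] by linarith
    then have "N ((1 / N x) *\<^sub>R x) \<le> 1"
      by (simp add: is_normD(3)[OF assms])
    then have "blinfun_apply y ((1 / N x) *\<^sub>R x) \<le> dual_norm N y"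
      using dual_norm_attained[OF assms, of y] by metis
    then show ?thesis
      using pos by (simp add: blinfun.scaleR_right field_simps)
  qed
  from bound[of x] bound[of "-x"] show ?thesis
    using is_norm_minus_commute[OF assms, of 0 x] by (simp add: blinfun.minus_right)
qed

lemma dual_norm_nonneg:
  fixes N :: "real ^ 'n \<Rightarrow> real"
  assumes "is_norm N"
  shows "0 \<le> dual_norm N y"
proof -
  have "N 0 \<le> 1"
    using is_normD(2)[OF assms, of 0] by simp
  then have "blinfun_apply y 0 \<le> dual_norm N y"
    using dual_norm_attained[OF assms, of y] by metis
  then show ?thesis
    by (simp add: blinfun.zero_right)
qed

lemma dual_norm_diff_scaleR_le:
  fixes N :: "real ^ 'n \<Rightarrow> real"
  assumes "is_norm N"
  shows "dual_norm N (y - a *\<^sub>R z) \<le> dual_norm N y + \<bar>a\<bar> * dual_norm N z"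
proof -
  obtain x where x: "N x \<le> 1" "dual_norm N (y - a *\<^sub>R z) = blinfun_apply (y - a *\<^sub>R z) x"
    using dual_norm_attained[OF assms] by metis
  have le: "\<bar>blinfun_apply w x\<bar> \<le> dual_norm N w" for w
    using abs_blinfun_apply_le_dual_norm[OF assms, of w x]
      mult_left_mono[OF x(1) dual_norm_nonneg[OF assms, of w]] by simp
  have "blinfun_apply (y - a *\<^sub>R z) x \<le> \<bar>blinfun_apply y x\<bar> + \<bar>a\<bar> * \<bar>blinfun_apply z x\<bar>"
    by (simp add: blinfun.diff_left blinfun.scaleR_left flip: abs_mult)
  also have "\<dots> \<le> dual_norm N y + \<bar>a\<bar> * dual_norm N z"
    by (intro add_mono mult_left_mono le) simp
  finally show ?thesis
    using x(2) by simp
qed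

section \<open>Gradients of strongly convex functions\<close>

lemma has_derivative_grad:
  assumes "h differentiable_on UNIV"
  shows "(h has_derivative blinfun_apply (grad h x)) (at x)"
proof -
  have "(h has_derivative frechet_derivative h (at x)) (at x)"
    using assms by (simp add: differentiable_on_def frechet_derivative_works)
  moreover from this have "bounded_linear (frechet_derivative h (at x))"
    by (rule has_derivative_bounded_linear)
  ultimately show ?thesis
    by (simp add: grad_def bounded_linear_Blinfun_apply)
qed

lemma strongly_convexD:
  assumes "strongly_convex N c h"
  shows "h differentiable_on UNIV"
    and "h y \<ge> h x + blinfun_apply (grad h x) (y - x) + c / 2 * (N (y - x))\<^sup>2"
  using assms unfolding strongly_convex_def by blast+

lemma grad_eq_at_min_minus_linear:
  assumes "h differentiable_on UNIV"
    and min: "\<And>z. h x - blinfun_apply y x \<le> h z - blinfun_apply y z"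
  shows "grad h x = y"
proof -
  have "((\<lambda>z. h z - blinfun_apply y z) has_derivative
          (\<lambda>v. blinfun_apply (grad h x) v - blinfun_apply y v)) (at x)"
    by (intro has_derivative_diff has_derivative_grad[OF assms(1)]
        bounded_linear_imp_has_derivative blinfun.bounded_linear_right)
  then have "(\<lambda>v. blinfun_apply (grad h x) v - blinfun_apply y v) = (\<lambda>v. 0)"
    using min by (intro differential_zero_maxmin[of x UNIV]) auto
  then show ?thesis
    by (metis blinfun_eqI eq_iff_diff_eq_0)
qed

text \<open>
  Compared with its value at \<open>0\<close>, the function \<open>h - y\<close> is bounded below by
  \<open>-A r + C r\<^sup>2\<close>, where \<open>r\<close> is the Euclidean norm of the argument. This is positive once
  \<open>r > A / C\<close>, so a minimizer over a ball of that radius is a global one.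
\<close>

lemma strongly_convex_minus_linear_attains_min:
  fixes N h :: "real ^ 'n \<Rightarrow> real"
  assumes "is_norm N" and "\<sigma> > 0" and "strongly_convex N \<sigma> h"
  obtains x where "\<And>z. h x - blinfun_apply y x \<le> h z - blinfun_apply y z"
proof -
  define F where "F = (\<lambda>z. h z - blinfun_apply y z)"
  obtain c where c: "c > 0" "\<And>x. c * norm x \<le> N x"
    using is_norm_ge_euclidean[OF assms(1)] by blast
  define A where "A = norm (grad h 0 - y)"
  define C where "C = \<sigma> / 2 * c\<^sup>2"
  define R where "R = A / C"
  have C: "C > 0" and R: "R \<ge> 0"
    using assms(2) c(1) by (simp_all add: C_def R_def A_def)
  have far: "F 0 < F z" if "norm z > R" for z
  proof -
    have "A * norm z < C * (norm z)\<^sup>2"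
    proof -
      have "norm z > 0"
        using that R by linarith
      moreover have "A < C * norm z"
        using that C by (simp add: R_def field_simps)
      ultimately show ?thesis
        using mult_strict_right_mono[of A "C * norm z" "norm z"]
        by (simp add: power2_eq_square mult.assoc)
    qed
    moreover have "C * (norm z)\<^sup>2 \<le> \<sigma> / 2 * (N z)\<^sup>2"
    proof -
      have "(c * norm z)\<^sup>2 \<le> (N z)\<^sup>2"
        using c by (intro power_mono) auto
      then show ?thesis
        using assms(2) by (simp add: C_def power_mult_distrib)
    qed
    moreover have "\<bar>blinfun_apply (grad h 0 - y) z\<bar> \<le> A * norm z"
      using norm_blinfun[of "grad h 0 - y" z] by (simp add: A_def)
    moreover have "h z \<ge> h 0 + blinfun_apply (grad h 0) z + \<sigma> / 2 * (N z)\<^sup>2"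
      using strongly_convexD(2)[OF assms(3), of 0 z] by simp
    ultimately show ?thesis
      by (simp add: F_def blinfun.diff_left blinfun.zero_right)
  qed
  have "continuous_on UNIV h"
    using strongly_convexD(1)[OF assms(3)] by (rule differentiable_imp_continuous_on)
  then have "continuous_on (cball 0 R) F"
    unfolding F_def by (intro continuous_intros) (auto intro: continuous_on_subset)
  moreover have zero: "(0 :: real ^ 'n) \<in> cball 0 R"
    using R by simp
  ultimately obtain x where x: "\<And>z. z \<in> cball 0 R \<Longrightarrow> F x \<le> F z"
    using continuous_attains_inf[OF compact_cball, of 0 R F] by blast
  have "F x \<le> F z" for z
    using x[of z] x[OF zero] far[of z] by (cases "norm z \<le> R") auto
  then show thesis
    unfolding F_def by (rule that)
qed

lemma bij_grad_strongly_convex: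
  fixes N h :: "real ^ 'n \<Rightarrow> real"
  assumes "is_norm N" and "\<sigma> > 0" and "strongly_convex N \<sigma> h"
  shows "bij (grad h)"
proof (rule bijI)
  show "inj (grad h)"
  proof (rule injI)
    fix x y :: "real ^ 'n"
    assume eq: "grad h x = grad h y"
    have "blinfun_apply (grad h y) (x - y) = - blinfun_apply (grad h y) (y - x)"
      by (simp add: blinfun.diff_right)
    then have "\<sigma> * (N (y - x))\<^sup>2 \<le> 0"
      using strongly_convexD(2)[OF assms(3), of x y] strongly_convexD(2)[OF assms(3), of y x]
      by (simp add: eq is_norm_minus_commute[OF assms(1), of x y])
    then have "N (y - x) = 0"
      using assms(2) by (simp add: mult_le_0_iff)
    then show "x = y"
      using is_normD(2)[OF assms(1)] by simp
  qed
  show "surj (grad h)"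
  proof -
    have "\<exists>x. y = grad h x" for y
    proof -
      obtain x where "\<And>z. h x - blinfun_apply y x \<le> h z - blinfun_apply y z"
        using strongly_convex_minus_linear_attains_min[OF assms] by blast
      then have "grad h x = y"
        by (rule grad_eq_at_min_minus_linear[OF strongly_convexD(1)[OF assms(3)]])
      then show ?thesis by blast
    qed
    then show ?thesis by (simp add: surj_def)
  qed
qed

section \<open>Bregman distances and the mirror step\<close>

text \<open>
  Up to an additive constant the objective is \<open>\<Psi>\<close> minus the functional \<open>grad \<Psi> a - y\<close>. The
  existence of a minimizer is what gives the Hilbert choice inside \<open>arg_min_on\<close> its meaning.
\<close>

lemma grad_mirror_step:
  fixes N \<Psi> :: "real ^ 'n \<Rightarrow> real"
  assumes "is_norm N" and "\<sigma> > 0" and "strongly_convex N \<sigma> \<Psi>"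
  shows "grad \<Psi> (arg_min_on (\<lambda>z. blinfun_apply y z + bregman \<Psi> z a) UNIV) = grad \<Psi> a - y"
    (is "grad \<Psi> ?b = ?w")
proof -
  define G where "G = (\<lambda>z. blinfun_apply y z + bregman \<Psi> z a)"
  have G: "G u \<le> G v \<longleftrightarrow> \<Psi> u - blinfun_apply ?w u \<le> \<Psi> v - blinfun_apply ?w v" for u v
    by (auto simp: G_def bregman_def blinfun.diff_left blinfun.diff_right)
  obtain m where "\<And>z. \<Psi> m - blinfun_apply ?w m \<le> \<Psi> z - blinfun_apply ?w z"
    using strongly_convex_minus_linear_attains_min[OF assms] by blast
  then have "is_arg_min G (\<lambda>z. z \<in> UNIV) m"
    by (simp add: is_arg_min_linorder G)
  then have "is_arg_min G (\<lambda>z. z \<in> UNIV) (arg_min_on G UNIV)"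
    unfolding arg_min_on_def arg_min_def by (rule someI)
  then have "G ?b \<le> G z" for z
    by (simp add: is_arg_min_linorder G_def)
  then show ?thesis
    using grad_eq_at_min_minus_linear[OF strongly_convexD(1)[OF assms(3)]] by (simp add: G)
qed

lemma bregman_three_point:
  "blinfun_apply (grad \<Psi> a - grad \<Psi> c) (a - s) =
     bregman \<Psi> s a - bregman \<Psi> s c + bregman \<Psi> a c"
  by (simp add: bregman_def blinfun.diff_left blinfun.diff_right)

lemma bregman_ge_strongly_convex:
  assumes "strongly_convex N \<sigma> \<Psi>"
  shows "bregman \<Psi> x y \<ge> \<sigma> / 2 * (N (x - y))\<^sup>2"
  using strongly_convexD(2)[OF assms, of y x] by (simp add: bregman_def)

text \<open>This is \<open>(p - c r)\<^sup>2 \<ge> 0\<close> divided by \<open>2c\<close>.\<close>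

lemma young_quadratic:
  fixes p r c :: real
  assumes "c > 0"
  shows "p * r - c / 2 * r\<^sup>2 \<le> 1 / (2 * c) * p\<^sup>2"
proof -
  have "0 \<le> (p - c * r)\<^sup>2 / (2 * c)"
    using assms by simp
  also have "\<dots> = 1 / (2 * c) * p\<^sup>2 - (p * r - c / 2 * r\<^sup>2)"
    using assms by (simp add: field_simps power2_eq_square)
  finally show ?thesis
    by simp
qed

text \<open>
  The symmetrised distance \<open>B(a,c) + B(c,a)\<close> is the pairing of the gradient difference with
  \<open>c - a\<close>, and \<open>B(c,a)\<close> already accounts for \<open>\<sigma>/2 \<parallel>c - a\<parallel>\<^sup>2\<close> of it.
\<close>

lemma bregman_le_dual_norm:
  fixes N \<Psi> :: "real ^ 'n \<Rightarrow> real"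
  assumes "is_norm N" and "\<sigma> > 0" and "strongly_convex N \<sigma> \<Psi>"
  shows "bregman \<Psi> a c \<le> 1 / (2 * \<sigma>) * (dual_norm N (grad \<Psi> c - grad \<Psi> a))\<^sup>2"
proof -
  have "bregman \<Psi> a c = blinfun_apply (grad \<Psi> c - grad \<Psi> a) (c - a) - bregman \<Psi> c a"
    by (simp add: bregman_def blinfun.diff_left blinfun.diff_right)
  also have "\<dots> \<le> dual_norm N (grad \<Psi> c - grad \<Psi> a) * N (c - a) - \<sigma> / 2 * (N (c - a))\<^sup>2"
    using abs_blinfun_apply_le_dual_norm[OF assms(1), of "grad \<Psi> c - grad \<Psi> a" "c - a"]
      bregman_ge_strongly_convex[OF assms(3), of c a] by linarith
  also have "\<dots> \<le> 1 / (2 * \<sigma>) * (dual_norm N (grad \<Psi> c - grad \<Psi> a))\<^sup>2"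
    using assms(2) by (rule young_quadratic)
  finally show ?thesis .
qed

section \<open>Inexact mirror descent\<close>

text \<open>
  The square of \<open>N (a - s)\<close> enters twice with opposite signs, from the strong convexity of \<open>f\<close> and
  from Young's inequality for the error term. Making the two cancel forces the constant
  \<open>1 / (2 * t * \<mu>)\<close>. The constant \<open>1 / \<sigma>\<close>, twice that of \<open>bregman_le_dual_norm\<close>, is the price of
  separating the error \<open>p\<close> from the step \<open>t q\<close> by \<open>(p + t q)\<^sup>2 \<le> 2 (p\<^sup>2 + t\<^sup>2 q\<^sup>2)\<close>.
\<close>

lemma mirror_descent_one_step:
  fixes N \<Psi> f :: "real ^ 'n \<Rightarrow> real"
  assumes N: "is_norm N" and \<sigma>: "\<sigma> > 0" and \<Psi>: "strongly_convex N \<sigma> \<Psi>"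
    and \<mu>: "\<mu> > 0" and f: "strongly_convex N \<mu> f" and t: "t > 0"
    and step: "grad \<Psi> b = grad \<Psi> a - t *\<^sub>R grad f a"
  shows "t * (f a - f s) \<le> bregman \<Psi> s a - bregman \<Psi> s c
           + (1 / \<sigma> * t\<^sup>2 * (dual_norm N (grad f a))\<^sup>2
              + (1 / (2 * t * \<mu>) + 1 / \<sigma>) * (dual_norm N (grad \<Psi> c - grad \<Psi> b))\<^sup>2)"
proof -
  define e where "e = grad \<Psi> c - grad \<Psi> b"
  define g where "g = grad f a"
  define p where "p = dual_norm N e"
  define q where "q = dual_norm N g"

  have "f a - f s \<le> blinfun_apply g (a - s) - \<mu> / 2 * (N (a - s))\<^sup>2"
    using strongly_convexD(2)[OF f, of a s]
    by (simp add: g_def blinfun.diff_right is_norm_minus_commute[OF N, of s a])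
  then have "t * (f a - f s) \<le> t * (blinfun_apply g (a - s) - \<mu> / 2 * (N (a - s))\<^sup>2)"
    using t by (intro mult_left_mono) simp_all
  also have "\<dots> = blinfun_apply (t *\<^sub>R g) (a - s) - t * \<mu> / 2 * (N (a - s))\<^sup>2"
    by (simp add: blinfun.scaleR_left algebra_simps)
  also have "t *\<^sub>R g = (grad \<Psi> a - grad \<Psi> c) + e"
    using step by (simp add: e_def g_def)
  also have "blinfun_apply \<dots> (a - s) =
      bregman \<Psi> s a - bregman \<Psi> s c + bregman \<Psi> a c + blinfun_apply e (a - s)"
    by (simp only: blinfun.add_left bregman_three_point)
  finally have decomp: "t * (f a - f s) \<le> bregman \<Psi> s a - bregman \<Psi> s c + bregman \<Psi> a c
      + (blinfun_apply e (a - s) - t * \<mu> / 2 * (N (a - s))\<^sup>2)"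
    by simp

  have "blinfun_apply e (a - s) \<le> p * N (a - s)"
    using abs_blinfun_apply_le_dual_norm[OF N, of e "a - s"] by (simp add: p_def)
  then have error: "blinfun_apply e (a - s) - t * \<mu> / 2 * (N (a - s))\<^sup>2 \<le> 1 / (2 * t * \<mu>) * p\<^sup>2"
    using young_quadratic[of "t * \<mu>" p "N (a - s)"] t \<mu> by (simp add: mult.assoc)

  have "grad \<Psi> c - grad \<Psi> a = e - t *\<^sub>R g"
    using step by (simp add: e_def g_def)
  then have "(dual_norm N (grad \<Psi> c - grad \<Psi> a))\<^sup>2 \<le> (p + t * q)\<^sup>2"
    using dual_norm_diff_scaleR_le[OF N, of e t g] dual_norm_nonneg[OF N] t
    by (intro power_mono) (simp_all add: p_def q_def)
  also have "\<dots> \<le> 2 * (p\<^sup>2 + t\<^sup>2 * q\<^sup>2)"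
    using sum_squares_bound[of p "t * q"] by (simp add: power2_sum power_mult_distrib mult.commute)
  finally have le: "1 / (2 * \<sigma>) * (dual_norm N (grad \<Psi> c - grad \<Psi> a))\<^sup>2
      \<le> 1 / (2 * \<sigma>) * (2 * (p\<^sup>2 + t\<^sup>2 * q\<^sup>2))"
    using \<sigma> by (intro mult_left_mono) simp_all
  have drift: "bregman \<Psi> a c \<le> 1 / \<sigma> * t\<^sup>2 * q\<^sup>2 + 1 / \<sigma> * p\<^sup>2"
  proof -
    have "1 / (2 * \<sigma>) * (2 * (p\<^sup>2 + t\<^sup>2 * q\<^sup>2)) = 1 / \<sigma> * t\<^sup>2 * q\<^sup>2 + 1 / \<sigma> * p\<^sup>2"
      using \<sigma> by (simp add: field_simps)
    with le show ?thesis
      using bregman_le_dual_norm[OF N \<sigma> \<Psi>, of a c] by linarith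
  qed

  show ?thesis
    using decomp error drift by (simp add: distrib_right flip: e_def g_def p_def q_def)
qed

theorem theorem3p1:
  fixes N \<Psi> f :: "real ^ 'n \<Rightarrow> real"
    and \<sigma> \<mu> :: real
    and xstar :: "real ^ 'n"
    and t :: "nat \<Rightarrow> real"
    and xt x :: "nat \<Rightarrow> real ^ 'n"
  assumes "is_norm N"
    and "mirror_potential \<Psi>"
    and "\<sigma> > 0" and "strongly_convex N \<sigma> \<Psi>"
    and "f differentiable_on UNIV"
    and "\<mu> > 0" and "strongly_convex N \<mu> f"
    and "\<forall>y. f xstar \<le> f y"
    and "\<forall>k\<ge>1. t k > 0"
    and "\<forall>k\<ge>1. x (k + 1) =
           arg_min_on (\<lambda>z. blinfun_apply (t k *\<^sub>R grad f (xt k)) z + bregman \<Psi> z (xt k)) UNIV"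
  shows "bij (grad \<Psi>) \<and>
         (\<forall>k\<ge>1. x (k + 1) = inv (grad \<Psi>) (grad \<Psi> (xt k) - t k *\<^sub>R grad f (xt k))) \<and>
         (\<forall>K\<ge>1. (\<Sum>k=1..K. t k * (f (xt k) - f xstar))
            \<le> bregman \<Psi> xstar (xt 1)
               + (\<Sum>k=1..K. 1 / \<sigma> * (t k)\<^sup>2 * (dual_norm N (grad f (xt k)))\<^sup>2
                    + (1 / (2 * t k * \<mu>) + 1 / \<sigma>)
                      * (dual_norm N (grad \<Psi> (xt (k + 1)) - grad \<Psi> (x (k + 1))))\<^sup>2))"
proof (intro conjI allI impI)
  have step: "grad \<Psi> (x (k + 1)) = grad \<Psi> (xt k) - t k *\<^sub>R grad f (xt k)" if "k \<ge> 1" for k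
    using grad_mirror_step[OF assms(1,3,4)] assms(10) that by simp
  show bij: "bij (grad \<Psi>)"
    using assms(1,3,4) by (rule bij_grad_strongly_convex)
  show "x (k + 1) = inv (grad \<Psi>) (grad \<Psi> (xt k) - t k *\<^sub>R grad f (xt k))" if "k \<ge> 1" for k
    unfolding step[OF that, symmetric] by (rule inv_f_f[OF bij_is_inj[OF bij], symmetric])
  fix K :: nat
  assume "K \<ge> 1"
  define D where "D k = bregman \<Psi> xstar (xt k)" for k
  define E where "E k = 1 / \<sigma> * (t k)\<^sup>2 * (dual_norm N (grad f (xt k)))\<^sup>2
      + (1 / (2 * t k * \<mu>) + 1 / \<sigma>)
        * (dual_norm N (grad \<Psi> (xt (k + 1)) - grad \<Psi> (x (k + 1))))\<^sup>2" for k
  have "(\<Sum>k=1..K. t k * (f (xt k) - f xstar)) \<le> (\<Sum>k=1..K. (D k - D (Suc k)) + E k)"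
  proof (rule sum_mono)
    fix k assume "k \<in> {1..K}"
    then have k: "k \<ge> 1" by simp
    with assms(9) have "t k > 0" by blast
    from mirror_descent_one_step[OF assms(1,3,4,6,7) this step[OF k], of xstar "xt (k + 1)"]
    show "t k * (f (xt k) - f xstar) \<le> (D k - D (Suc k)) + E k"
      by (simp add: D_def E_def)
  qed
  also have "\<dots> = D 1 - D (Suc K) + (\<Sum>k=1..K. E k)"
    using sum_Suc_diff[of 1 K "\<lambda>k. - D k"] \<open>K \<ge> 1\<close>
    by (simp add: sum.distrib)
  also have "\<dots> \<le> D 1 + (\<Sum>k=1..K. E k)"
  proof -
    have "0 \<le> \<sigma> / 2 * (N (xstar - xt (Suc K)))\<^sup>2"
      using assms(3) by simp
    also have "\<dots> \<le> D (Suc K)"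
      unfolding D_def by (rule bregman_ge_strongly_convex[OF assms(4)])
    finally show ?thesis by simp
  qed
  finally show "(\<Sum>k=1..K. t k * (f (xt k) - f xstar))
      \<le> bregman \<Psi> xstar (xt 1)
         + (\<Sum>k=1..K. 1 / \<sigma> * (t k)\<^sup>2 * (dual_norm N (grad f (xt k)))\<^sup>2
              + (1 / (2 * t k * \<mu>) + 1 / \<sigma>)
                * (dual_norm N (grad \<Psi> (xt (k + 1)) - grad \<Psi> (x (k + 1))))\<^sup>2)"
    by (simp only: D_def E_def)
qed

end
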